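(* Let $P$ be a finite poset and let $t\geq 2$ be a fixed integer. Then, as $n\to\infty$, either $\mathrm{sat}^{\star}([t]^n,P)=\Omega(\sqrt{n})$ or $\mathrm{sat}^{\star}([t]^n,P)=O(1)$.
   Context: For positive integers $n,t$, $[n]=\{1,\dots,n\}$ and the hypergrid $[t]^n$ is the set of functions $f:[n]\to[t]$, partially ordered by $f\leq g$ iff $f(i)\leq g(i)$ for all $i\in[n]$. An induced copy of a poset $P$ in a family $\mathcal{F}\subseteq[t]^n$ is an injective map $\phi:P\to\mathcal{F}$ such that $\phi(x)\leq\phi(y)$ iff $x\leq_P y$. A family $\mathcal{F}\subseteq[t]^n$ is induced $P$-free if it contains no induced copy of $P$; it is induced $P$-saturated if it is induced $P$-free and for every $f\in[t]^n\setminus\mathcal{F}$ the family $\mathcal{F}\cup\{f\}$ contains an induced copy of $P$. Whenever $P$ embeds as an induced subposet of $[t]^n$, $\mathrm{sat}^{\star}([t]^n,P)$ denotes the minimum size of an induced $P$-saturated family in $[t]^n$. Asymptotic notation is as $n\to\infty$ with $t$ and $P$ fixed. *)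

theory Defs
  imports Main "HOL-Library.Landau_Symbols"
begin

text \<open>The hypergrid [t]^n: functions [n] -> [t], represented as lists of length n
  (entry i-1 is the value at coordinate i) with entries in {1..t}.\<close>
definition hypergrid :: "nat \<Rightarrow> nat \<Rightarrow> nat list set" where
  "hypergrid t n = {f. length f = n \<and> set f \<subseteq> {1..t}}"

definition grid_le :: "nat list \<Rightarrow> nat list \<Rightarrow> bool" where
  "grid_le f g = list_all2 (\<le>) f g"

definition induced_copy :: "('p::order \<Rightarrow> nat list) \<Rightarrow> nat list set \<Rightarrow> bool" where
  "induced_copy \<phi> F \<longleftrightarrow> inj \<phi> \<and> (\<forall>x. \<phi> x \<in> F) \<and>
     (\<forall>x y. grid_le (\<phi> x) (\<phi> y) \<longleftrightarrow> x \<le> y)"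

definition induced_free :: "'p::order itself \<Rightarrow> nat list set \<Rightarrow> bool" where
  "induced_free P F \<longleftrightarrow> \<not> (\<exists>\<phi> :: 'p \<Rightarrow> nat list. induced_copy \<phi> F)"

definition induced_saturated :: "'p::order itself \<Rightarrow> nat \<Rightarrow> nat \<Rightarrow> nat list set \<Rightarrow> bool" where
  "induced_saturated P t n F \<longleftrightarrow> F \<subseteq> hypergrid t n \<and> induced_free P F \<and>
     (\<forall>f \<in> hypergrid t n - F. \<not> induced_free P (insert f F))"

text \<open>sat^*([t]^n, P): minimum size of an induced P-saturated family in [t]^n.
  (Only meaningful when P embeds into [t]^n, which holds for all large n.)\<close>
definition sat_star :: "nat \<Rightarrow> nat \<Rightarrow> 'p::order itself \<Rightarrow> nat" where
  "sat_star t n P = Min {card F | F. induced_saturated P t n F}"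

end

theory Submission
  imports Defs
begin

text \<open>
  Let \<open>F\<close> be saturated in \<open>[t]^n\<close> with \<open>|F|\<^sup>2 < n\<close>. A pair \<open>A, B\<close> of members of \<open>F\<close> with
  \<open>A \<le> B\<close> failing at exactly one coordinate determines that coordinate, so some coordinate \<open>i\<close>
  belongs to no pair: deleting it does not change the order on \<open>F\<close>. Replace the entry at \<open>i\<close> by a
  block of \<open>m \<ge> 1\<close> entries, all 1 if the entry was 1 and all \<open>t\<close> otherwise. The new family is
  order isomorphic to \<open>F\<close>, and every point of the larger grid compares with it in the same way as
  some point of \<open>[t]^n\<close> compares with \<open>F\<close>, so it is again saturated. Hence a single \<open>n\<close> with
  \<open>sat(n)\<^sup>2 < n\<close> bounds \<open>sat(n')\<close> by \<open>sat(n)\<close> for all \<open>n' \<ge> n\<close>.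
\<close>

section \<open>The componentwise order on lists\<close>

lemma grid_le_refl [simp]: "grid_le f f"
  by (simp add: grid_le_def list_all2_refl)

lemma grid_le_antisym: "grid_le f g \<Longrightarrow> grid_le g f \<Longrightarrow> f = g"
  unfolding grid_le_def by (rule list_all2_antisym) auto

lemma grid_le_trans: "grid_le f g \<Longrightarrow> grid_le g h \<Longrightarrow> grid_le f h"
  unfolding grid_le_def by (rule list_all2_trans[of "(\<le>)" "(\<le>)"]) auto

lemma grid_le_append:
  "length f = length f' \<Longrightarrow> grid_le (f @ g) (f' @ g') \<longleftrightarrow> grid_le f f' \<and> grid_le g g'"
  by (simp add: grid_le_def list_all2_append)

lemma grid_le_replicate_left:
  "grid_le (replicate m c) b \<longleftrightarrow> length b = m \<and> (\<forall>x\<in>set b. c \<le> x)"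
  by (auto simp: grid_le_def list_all2_conv_all_nth all_set_conv_all_nth)

lemma grid_le_replicate_right:
  "grid_le b (replicate m c) \<longleftrightarrow> length b = m \<and> (\<forall>x\<in>set b. x \<le> c)"
  by (auto simp: grid_le_def list_all2_conv_all_nth all_set_conv_all_nth)

lemma finite_hypergrid: "finite (hypergrid t n)"
  using finite_lists_length_eq[of "{1..t}" n] by (simp add: hypergrid_def conj_commute)

section \<open>Deleting and inserting a coordinate\<close>

definition delete_at :: "nat \<Rightarrow> 'a list \<Rightarrow> 'a list" where
  "delete_at i f = take i f @ drop (Suc i) f"

definition insert_at :: "nat \<Rightarrow> 'a \<Rightarrow> 'a list \<Rightarrow> 'a list" where
  "insert_at i c h = take i h @ c # drop i h"

lemma length_delete_at: "i < length f \<Longrightarrow> length (delete_at i f) = length f - 1"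
  by (auto simp: delete_at_def)

lemma grid_le_split_at:
  assumes "i < length f" "length f = length g"
  shows "grid_le f g \<longleftrightarrow> f ! i \<le> g ! i \<and> grid_le (delete_at i f) (delete_at i g)"
proof -
  have "grid_le f g \<longleftrightarrow>
      grid_le (take i f @ f ! i # drop (Suc i) f) (take i g @ g ! i # drop (Suc i) g)"
    using assms by (simp flip: id_take_nth_drop)
  also have "\<dots> \<longleftrightarrow> f ! i \<le> g ! i \<and> grid_le (delete_at i f) (delete_at i g)"
    using assms by (auto simp: grid_le_append delete_at_def) (auto simp: grid_le_def)
  finally show ?thesis .
qed

lemma
  assumes "i \<le> length h"
  shows length_insert_at: "length (insert_at i c h) = Suc (length h)"
    and nth_insert_at: "insert_at i c h ! i = c"
    and delete_at_insert_at: "delete_at i (insert_at i c h) = h"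
  using assms by (auto simp: insert_at_def delete_at_def nth_append)

lemma hypergrid_delete_at:
  "f \<in> hypergrid t n \<Longrightarrow> i < n \<Longrightarrow> delete_at i f \<in> hypergrid t (n - 1)"
  using set_take_subset[of i f] set_drop_subset[of "Suc i" f]
  by (auto simp: hypergrid_def length_delete_at) (auto simp: delete_at_def)

lemma hypergrid_insert_at:
  "h \<in> hypergrid t (n - 1) \<Longrightarrow> i < n \<Longrightarrow> c \<in> {1..t} \<Longrightarrow> insert_at i c h \<in> hypergrid t n"
  using set_take_subset[of i h] set_drop_subset[of i h]
  by (auto simp: hypergrid_def length_insert_at) (auto simp: insert_at_def)

text \<open>Injectivity is automatic: points with equal images are related both ways, and the order
  on the poset is antisymmetric.\<close>

lemma induced_copy_iff:
  "induced_copy \<phi> F \<longleftrightarrow> (\<forall>x. \<phi> x \<in> F) \<and> (\<forall>x y. grid_le (\<phi> x) (\<phi> y) \<longleftrightarrow> x \<le> y)"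
proof -
  have "inj \<phi>" if "\<forall>x y. grid_le (\<phi> x) (\<phi> y) \<longleftrightarrow> x \<le> y"
    by (rule injI) (metis that grid_le_refl order.antisym)
  then show ?thesis by (auto simp: induced_copy_def)
qed

text \<open>Composing with \<open>\<psi>\<close> turns a copy in \<open>G\<close> into a copy in
  \<open>H\<close>.\<close>

lemma induced_free_embedding:
  assumes "induced_free P H" "\<psi> ` G \<subseteq> H"
    and "\<And>x y. x \<in> G \<Longrightarrow> y \<in> G \<Longrightarrow> grid_le (\<psi> x) (\<psi> y) \<longleftrightarrow> grid_le x y"
  shows "induced_free P G"
  unfolding induced_free_def
proof
  assume "\<exists>\<phi> :: 'a \<Rightarrow> _. induced_copy \<phi> G"
  then obtain \<phi> :: "'a \<Rightarrow> nat list" where "induced_copy \<phi> G" ..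
  then have "induced_copy (\<psi> \<circ> \<phi>) H"
    using assms(2,3) by (auto simp: induced_copy_iff)
  then show False
    using assms(1) by (auto simp: induced_free_def)
qed

text \<open>A maximal free family is saturated. This makes the \<open>Min\<close> in
  \<open>sat_star\<close> range over a nonempty set for every \<open>n\<close>, even if the poset
  does not embed in the grid.\<close>

lemma induced_saturated_exists: "\<exists>F. induced_saturated P t n F"
proof -
  let ?S = "{F. F \<subseteq> hypergrid t n \<and> induced_free P F}"
  have "finite ?S"
    by (rule finite_subset[of _ "Pow (hypergrid t n)"]) (auto simp: finite_hypergrid)
  \<comment> \<open>A type is nonempty, so a copy has at least one point.\<close>
  moreover have "{} \<in> ?S"
    by (auto simp: induced_free_def induced_copy_def)
  ultimately obtain F where F: "F \<in> ?S" "\<And>G. G \<in> ?S \<Longrightarrow> F \<subseteq> G \<Longrightarrow> F = G"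
    by (metis (no_types, lifting) finite_has_maximal empty_iff)
  have "\<not> induced_free P (insert f F)" if "f \<in> hypergrid t n - F" for f
    using F(1) F(2)[of "insert f F"] that by blast
  then show ?thesis
    using F(1) by (auto simp: induced_saturated_def)
qed

lemma finite_card_induced_saturated: "finite {card F | F. induced_saturated P t n F}"
proof (rule finite_subset)
  show "{card F | F. induced_saturated P t n F} \<subseteq> card ` Pow (hypergrid t n)"
    by (auto simp: induced_saturated_def)
qed (simp add: finite_hypergrid)

lemma sat_star_le: "induced_saturated P t n F \<Longrightarrow> sat_star t n P \<le> card F"
  unfolding sat_star_def by (rule Min_le) (auto simp: finite_card_induced_saturated)

lemma sat_star_attained: "\<exists>F. induced_saturated P t n F \<and> card F = sat_star t n P"
proof -
  have "sat_star t n P \<in> {card F | F. induced_saturated P t n F}"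
    unfolding sat_star_def
    by (rule Min_in[OF finite_card_induced_saturated]) (use induced_saturated_exists in auto)
  then show ?thesis by auto
qed

section \<open>A coordinate that the order on a small family does not need\<close>

lemma order_preserving_coordinate_exists:
  assumes F: "F \<subseteq> hypergrid t n" and small: "(card F)\<^sup>2 < n"
  shows "\<exists>i<n. \<forall>A\<in>F. \<forall>B\<in>F. grid_le (delete_at i A) (delete_at i B) \<longrightarrow> grid_le A B"
proof (rule ccontr)
  assume "\<not> ?thesis"
  then have "\<forall>i\<in>{..<n}. \<exists>p\<in>F \<times> F.
      grid_le (delete_at i (fst p)) (delete_at i (snd p)) \<and> \<not> grid_le (fst p) (snd p)"
    by fastforce
  then obtain w where w: "\<And>i. i < n \<Longrightarrow> w i \<in> F \<times> F \<and>
      grid_le (delete_at i (fst (w i))) (delete_at i (snd (w i))) \<and>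
      \<not> grid_le (fst (w i)) (snd (w i))"
    by (metis lessThan_iff)
  have only: "{j. j < n \<and> \<not> fst (w i) ! j \<le> snd (w i) ! j} = {i}" if "i < n" for i
  proof -
    obtain A B where AB: "w i = (A, B)" by fastforce
    have len: "length A = n" "length B = n"
      using w[OF that] F AB by (auto simp: hypergrid_def)
    have le: "grid_le (delete_at i A) (delete_at i B)" and nle: "\<not> grid_le A B"
      using w[OF that] AB by auto
    have "\<not> A ! i \<le> B ! i"
      using le nle grid_le_split_at[of i A B] len that by auto
    moreover have "A ! j \<le> B ! j" if "j < n" "j \<noteq> i" for j
    proof -
      \<comment> \<open>Writing the same value at \<open>i\<close> in both lists makes the
        comparison there trivial. \<open>grid_le\<close> puts no bounds on entries, so 0 may lie
        outside the grid.\<close>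
      have "grid_le (A[i := 0]) (B[i := 0])"
        using le len \<open>i < n\<close> by (subst grid_le_split_at[of i]) (auto simp: delete_at_def)
      then have "A[i := 0] ! j \<le> B[i := 0] ! j"
        using that len by (auto simp: grid_le_def list_all2_conv_all_nth)
      then show ?thesis using that by simp
    qed
    ultimately show ?thesis using that AB by auto
  qed
  have "inj_on w {..<n}"
  proof (rule inj_onI)
    fix i j assume "i \<in> {..<n}" "j \<in> {..<n}" "w i = w j"
    then have "{i} = {j}" using only by (metis lessThan_iff)
    then show "i = j" by simp
  qed
  moreover have "w ` {..<n} \<subseteq> F \<times> F" using w by blast
  moreover have "finite (F \<times> F)"
    using finite_subset[OF F finite_hypergrid] by simp
  ultimately have "card {..<n} \<le> card (F \<times> F)"
    by (rule card_inj_on_le)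
  then show False
    using small by (simp add: card_cartesian_product power2_eq_square)
qed

section \<open>Carrying saturation over to a larger grid\<close>

text \<open>In \<open>types\<close> there is no need to ask for \<open>u \<notin> F\<close> when \<open>g \<notin> \<psi> ` F\<close>, since \<open>u \<in> F\<close> would
  force \<open>g = \<psi> u\<close>.\<close>
lemma induced_saturated_image:
  assumes sat: "induced_saturated P t n F"
    and sub: "\<psi> ` F \<subseteq> hypergrid t n'"
    and emb: "\<And>x y. x \<in> F \<Longrightarrow> y \<in> F \<Longrightarrow> grid_le (\<psi> x) (\<psi> y) \<longleftrightarrow> grid_le x y"
    and types: "\<And>g. g \<in> hypergrid t n' \<Longrightarrow> \<exists>u\<in>hypergrid t n. \<forall>x\<in>F.
      (grid_le (\<psi> x) g \<longleftrightarrow> grid_le x u) \<and> (grid_le g (\<psi> x) \<longleftrightarrow> grid_le u x)"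
  shows "induced_saturated P t n' (\<psi> ` F)"
proof -
  have free: "induced_free P F"
    and ext: "\<And>f. f \<in> hypergrid t n - F \<Longrightarrow> \<not> induced_free P (insert f F)"
    using sat by (auto simp: induced_saturated_def)
  have inj: "inj_on \<psi> F"
    by (rule inj_onI) (metis emb grid_le_antisym grid_le_refl)
  have "induced_free P (\<psi> ` F)"
    by (rule induced_free_embedding[OF free, of "the_inv_into F \<psi>"])
      (auto simp: the_inv_into_f_f[OF inj] emb)
  moreover have "\<not> induced_free P (insert g (\<psi> ` F))"
    if g: "g \<in> hypergrid t n' - \<psi> ` F" for g
  proof
    assume contr: "induced_free P (insert g (\<psi> ` F))"
    obtain u where u: "u \<in> hypergrid t n"
      and lo: "\<And>x. x \<in> F \<Longrightarrow> grid_le (\<psi> x) g \<longleftrightarrow> grid_le x u"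
      and hi: "\<And>x. x \<in> F \<Longrightarrow> grid_le g (\<psi> x) \<longleftrightarrow> grid_le u x"
      using types[of g] g by blast
    have "u \<notin> F"
      using lo[of u] hi[of u] g grid_le_antisym by auto
    \<comment> \<open>\<open>u\<close> compares with \<open>F\<close> as \<open>g\<close> does with
      the image, so sending \<open>u\<close> to \<open>g\<close> extends \<open>\<psi>\<close> to an
      embedding.\<close>
    have "induced_free P (insert u F)"
      by (rule induced_free_embedding[OF contr, of "\<psi>(u := g)"])
        (use \<open>u \<notin> F\<close> lo hi emb in auto)
    then show False using ext u \<open>u \<notin> F\<close> by blast
  qed
  ultimately show ?thesis
    using sub by (auto simp: induced_saturated_def)
qed

text \<open>The block stands in front rather than at position \<open>i\<close>; permuting
  coordinates does not affect the order. Only the extreme values 1 and \<open>t\<close> occur in it,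
  so comparing it with \<open>m\<close> entries of another point only asks whether these are all 1,
  all \<open>t\<close>, or neither.\<close>

definition blow_up :: "nat \<Rightarrow> nat \<Rightarrow> nat \<Rightarrow> nat list \<Rightarrow> nat list" where
  "blow_up t m i f = replicate m (if f ! i = 1 then 1 else t) @ delete_at i f"

lemma induced_saturated_blow_up:
  assumes t: "t \<ge> 2" and m: "m \<ge> 1" and i: "i < n"
    and sat: "induced_saturated P t n F"
    and good: "\<And>A B. A \<in> F \<Longrightarrow> B \<in> F \<Longrightarrow> grid_le (delete_at i A) (delete_at i B) \<Longrightarrow> grid_le A B"
  shows "induced_saturated P t (m + (n - 1)) (blow_up t m i ` F)"
proof (rule induced_saturated_image[OF sat])
  have F: "F \<subseteq> hypergrid t n" using sat by (auto simp: induced_saturated_def)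
  have len: "length x = n" if "x \<in> F" for x
    using that F by (auto simp: hypergrid_def)
  have range: "1 \<le> x ! i" "x ! i \<le> t" if "x \<in> F" for x
  proof -
    have "x ! i \<in> set x" using len[OF that] i by simp
    moreover have "set x \<subseteq> {1..t}" using that F by (auto simp: hypergrid_def)
    ultimately show "1 \<le> x ! i" "x ! i \<le> t" by auto
  qed
  show "blow_up t m i ` F \<subseteq> hypergrid t (m + (n - 1))"
  proof
    fix y assume "y \<in> blow_up t m i ` F"
    then obtain x where x: "x \<in> F" "y = blow_up t m i x" by blast
    then have "delete_at i x \<in> hypergrid t (n - 1)" using hypergrid_delete_at F i by blast
    then show "y \<in> hypergrid t (m + (n - 1))"
      using t by (auto simp: x(2) blow_up_def hypergrid_def split: if_splits)
  qed
  show "grid_le (blow_up t m i x) (blow_up t m i y) \<longleftrightarrow> grid_le x y"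
    if "x \<in> F" "y \<in> F" for x y
  proof -
    have "grid_le x y \<longleftrightarrow> x ! i \<le> y ! i \<and> grid_le (delete_at i x) (delete_at i y)"
      using grid_le_split_at len that i by simp
    \<comment> \<open>From the images back to \<open>x\<close> and \<open>y\<close>,
      \<open>good\<close> suffices whatever the blocks are; conversely, collapsing all entries above
      1 to \<open>t\<close> is monotone.\<close>
    then show ?thesis
      using good[OF that] range[OF that(1)] range[OF that(2)] t
      by (auto simp: blow_up_def grid_le_append grid_le_replicate_left)
  qed
  fix g assume g: "g \<in> hypergrid t (m + (n - 1))"
  define b h where "b = take m g" and "h = drop m g"
  have g_eq: "g = b @ h" by (simp add: b_def h_def)
  have b: "length b = m" "set b \<subseteq> {1..t}" and h: "h \<in> hypergrid t (n - 1)"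
    using g set_take_subset[of m g] set_drop_subset[of m g]
    by (auto simp: hypergrid_def b_def h_def)
  have lenh: "length h = n - 1" using h by (simp add: hypergrid_def)
  \<comment> \<open>\<open>D\<close> and \<open>U\<close> mark the members below and above
    \<open>g\<close> when the block is ignored.\<close>
  define D U where "D x \<longleftrightarrow> grid_le (delete_at i x) h" and "U x \<longleftrightarrow> grid_le h (delete_at i x)" for x
  \<comment> \<open>Through \<open>h\<close>, \<open>A\<close> is below \<open>B\<close> away from
    \<open>i\<close>, and \<open>good\<close> extends this to \<open>i\<close>.\<close>
  have mono: "A ! i \<le> B ! i" if "A \<in> F" "B \<in> F" "D A" "U B" for A B
    using good[of A B] that grid_le_trans[of "delete_at i A" h "delete_at i B"]
      grid_le_split_at[of i A B] len i by (auto simp: D_def U_def)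
  \<comment> \<open>The hypothesis \<open>m \<ge> 1\<close> enters here: \<open>set b\<close> must
    be nonempty to be a singleton.\<close>
  have below: "grid_le (blow_up t m i x) g \<longleftrightarrow> D x \<and> (x ! i = 1 \<or> set b = {t})"
    and above: "grid_le g (blow_up t m i x) \<longleftrightarrow> U x \<and> (x ! i \<noteq> 1 \<or> set b = {1})" for x
  proof -
    have "set b = {a} \<longleftrightarrow> (\<forall>y\<in>set b. y = a)" for a
      using b(1) m by (cases b) auto
    then have "(\<forall>y\<in>set b. t \<le> y) \<longleftrightarrow> set b = {t}" "(\<forall>y\<in>set b. y \<le> 1) \<longleftrightarrow> set b = {1}"
      using b(2) by (auto simp: subset_iff order_antisym)
    moreover have "\<forall>y\<in>set b. 1 \<le> y" "\<forall>y\<in>set b. y \<le> t" using b(2) by auto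
    ultimately show
      "grid_le (blow_up t m i x) g \<longleftrightarrow> D x \<and> (x ! i = 1 \<or> set b = {t})"
      "grid_le g (blow_up t m i x) \<longleftrightarrow> U x \<and> (x ! i \<noteq> 1 \<or> set b = {1})"
      using b(1) by (auto simp: g_eq blow_up_def D_def U_def grid_le_append
        grid_le_replicate_left grid_le_replicate_right)
  qed
  \<comment> \<open>The point \<open>u\<close> is \<open>h\<close> with an entry \<open>c\<close>
    inserted at \<open>i\<close>. Away from \<open>i\<close> its comparisons are already
    \<open>D\<close> and \<open>U\<close>, so only \<open>c\<close> has to be chosen.\<close>
  have suffices: "\<exists>u\<in>hypergrid t n. \<forall>x\<in>F.
      (grid_le (blow_up t m i x) g \<longleftrightarrow> grid_le x u) \<and> (grid_le g (blow_up t m i x) \<longleftrightarrow> grid_le u x)"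
    if c: "c \<in> {1..t}" and
      cD: "\<And>x. x \<in> F \<Longrightarrow> D x \<Longrightarrow> x ! i = 1 \<or> set b = {t} \<longleftrightarrow> x ! i \<le> c" and
      cU: "\<And>x. x \<in> F \<Longrightarrow> U x \<Longrightarrow> x ! i \<noteq> 1 \<or> set b = {1} \<longleftrightarrow> c \<le> x ! i" for c
  proof (intro bexI ballI)
    show "insert_at i c h \<in> hypergrid t n" by (rule hypergrid_insert_at[OF h i c])
    fix x assume x: "x \<in> F"
    have "i \<le> length h" using lenh i by simp
    note ins = length_insert_at[OF this] nth_insert_at[OF this] delete_at_insert_at[OF this]
    have "grid_le x (insert_at i c h) \<longleftrightarrow> x ! i \<le> c \<and> D x"
      using grid_le_split_at[of i x "insert_at i c h"] len[OF x] lenh i by (simp add: ins D_def)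
    moreover have "grid_le (insert_at i c h) x \<longleftrightarrow> c \<le> x ! i \<and> U x"
      using grid_le_split_at[of i "insert_at i c h" x] len[OF x] lenh i by (simp add: ins U_def)
    ultimately show "(grid_le (blow_up t m i x) g \<longleftrightarrow> grid_le x (insert_at i c h)) \<and>
        (grid_le g (blow_up t m i x) \<longleftrightarrow> grid_le (insert_at i c h) x)"
      using below above cD[OF x] cU[OF x] by blast
  qed
  show "\<exists>u\<in>hypergrid t n. \<forall>x\<in>F.
      (grid_le (blow_up t m i x) g \<longleftrightarrow> grid_le x u) \<and> (grid_le g (blow_up t m i x) \<longleftrightarrow> grid_le u x)"
  \<comment> \<open>In the first case \<open>g\<close> is above just those members of
    \<open>D\<close> with entry 1 and below all of \<open>U\<close>: either \<open>b\<close> is all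
    1, or by \<open>mono\<close> the entry of \<open>A\<close> forces every entry in
    \<open>U\<close> above 1. So \<open>c = 1\<close> works.\<close>
  proof (cases "set b = {1} \<or> (set b \<noteq> {t} \<and> (\<exists>A\<in>F. D A \<and> A ! i \<noteq> 1))")
    case True
    show ?thesis
    proof (rule suffices[of 1])
      show "1 \<in> {1..t}" using t by simp
      show "x ! i = 1 \<or> set b = {t} \<longleftrightarrow> x ! i \<le> 1" if "x \<in> F" "D x" for x
        using True t range[OF that(1)] by auto
      show "x ! i \<noteq> 1 \<or> set b = {1} \<longleftrightarrow> 1 \<le> x ! i" if "x \<in> F" "U x" for x
        using True range that mono by (metis le_antisym)
    qed
  next
    case False
    \<comment> \<open>Now \<open>g\<close> is above all of \<open>D\<close> and below just those
      members of \<open>U\<close> whose entry is not 1. So \<open>c\<close> must bound the entries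
      from \<open>D\<close> and exceed 1, whence the 2; \<open>mono\<close> keeps it below the other
      entries from \<open>U\<close>.\<close>
    define S where "S = insert 2 ((\<lambda>A. A ! i) ` {A \<in> F. D A})"
    have fin: "finite S"
      using finite_subset[OF F finite_hypergrid] by (simp add: S_def)
    have ge: "s \<le> Max S" if "s \<in> S" for s using fin that by simp
    have two: "2 \<le> Max S" by (rule ge) (simp add: S_def)
    have in_S: "Max S \<in> S" using fin by (intro Max_in) (auto simp: S_def)
    show ?thesis
    proof (rule suffices[of "Max S"])
      show "Max S \<in> {1..t}" using in_S two t range by (auto simp: S_def)
      show "x ! i = 1 \<or> set b = {t} \<longleftrightarrow> x ! i \<le> Max S" if "x \<in> F" "D x" for x
        using False that ge[of "x ! i"] by (auto simp: S_def)
      show "x ! i \<noteq> 1 \<or> set b = {1} \<longleftrightarrow> Max S \<le> x ! i" if x: "x \<in> F" "U x" for x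
      proof -
        have "Max S \<le> x ! i" if "x ! i \<noteq> 1"
          using in_S mono[OF _ x(1) _ x(2)] range(1)[OF x(1)] that by (auto simp: S_def)
        moreover have "set b \<noteq> {1}" using False by blast
        moreover have "\<not> Max S \<le> 1" using two by linarith
        ultimately show ?thesis by metis
      qed
    qed
  qed
qed

section \<open>From one small value to the asymptotic dichotomy\<close>

theorem mainTheorem1:
  fixes t :: nat
  assumes "t \<ge> 2"
  shows "(\<lambda>n. real (sat_star t n TYPE('p::{order,finite}))) \<in> \<Omega>(\<lambda>n. sqrt (real n))
       \<or> (\<lambda>n. real (sat_star t n TYPE('p::{order,finite}))) \<in> O(\<lambda>n. 1)"
proof (cases "\<forall>n. n \<le> (sat_star t n TYPE('p))\<^sup>2")
  case True
  have "sqrt (real n) \<le> real (sat_star t n TYPE('p))" for n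
    using True by (intro real_le_lsqrt) (auto simp flip: of_nat_power)
  then have "(\<lambda>n. real (sat_star t n TYPE('p))) \<in> \<Omega>(\<lambda>n. sqrt (real n))"
    by (intro landau_omega.bigI[of 1]) auto
  then show ?thesis ..
next
  case False
  then obtain n where n: "(sat_star t n TYPE('p))\<^sup>2 < n" by (auto simp: not_le)
  obtain F where F: "induced_saturated TYPE('p) t n F" "card F = sat_star t n TYPE('p)"
    using sat_star_attained by blast
  then have sub: "F \<subseteq> hypergrid t n" by (simp add: induced_saturated_def)
  obtain i where i: "i < n"
    "\<And>A B. A \<in> F \<Longrightarrow> B \<in> F \<Longrightarrow> grid_le (delete_at i A) (delete_at i B) \<Longrightarrow> grid_le A B"
    using order_preserving_coordinate_exists[OF sub] n F(2) by auto
  have "sat_star t k TYPE('p) \<le> card F" if "k \<ge> n" for k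
  proof -
    \<comment> \<open>One coordinate is traded for \<open>m\<close>, which must bring the dimension
      to \<open>k\<close>; \<open>m \<ge> 1\<close> as \<open>k \<ge> n\<close> and
      \<open>n > 0\<close>.\<close>
    define m where "m = k - (n - 1)"
    have m: "m \<ge> 1" "m + (n - 1) = k" using that i(1) by (auto simp: m_def)
    have "sat_star t k TYPE('p) \<le> card (blow_up t m i ` F)"
      using sat_star_le[OF induced_saturated_blow_up[OF assms m(1) i(1) F(1) i(2)]] m(2) by simp
    also have "\<dots> \<le> card F"
      using finite_subset[OF sub finite_hypergrid] by (rule card_image_le)
    finally show ?thesis .
  qed
  then have "(\<lambda>n. real (sat_star t n TYPE('p))) \<in> O(\<lambda>n. 1)"
    by (intro bigoI[of _ "real (card F)"] eventually_sequentiallyI[of n]) auto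
  then show ?thesis ..
qed

end
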